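(* $\mathcal{W}(\mathbf{\Delta}^1_1) \in \mathbf{\Sigma}^1_2(2^{2^\star}) \setminus \mathbf{\Pi}^0_2$; that is, the set $\mathcal{W}(\mathbf{\Delta}^1_1)$ is a $\mathbf{\Sigma}^1_2$-subset of the space $2^{2^\star}$ and it is not a $\mathbf{\Pi}^0_2$-subset of $2^{2^\star}$.
   Context: Let $2=\{0,1\}$ be the two-letter alphabet, $2^\star$ the set of finite words over it (including the empty word $\lambda$), and $2^\omega$ the set of infinite words over it, equipped with the Cantor topology (product of discrete topologies). A dictionary is a subset $V \subseteq 2^\star$; its $\omega$-power is $V^\omega = \{u_1\cdot u_2\cdots u_n\cdots \mid \forall i\geq 1,\ u_i \in V\setminus\{\lambda\}\} \subseteq 2^\omega$. Dictionaries are identified with their characteristic functions, i.e. with elements of the space $2^{2^\star}$ of functions $2^\star\to\{0,1\}$, equipped with the product topology of the discrete topology on $\{0,1\}$ (so it is homeomorphic to the Cantor space). Define $\mathcal{W}(\mathbf{\Delta}^1_1) = \{A\subseteq 2^\star \mid A^\omega \text{ is a Borel subset of } 2^\omega\}$, viewed as a subset of $2^{2^\star}$. The classes $\mathbf{\Pi}^0_2$ (countable intersections of open sets) and $\mathbf{\Sigma}^1_2$ (projections of co-analytic sets) are the usual boldface classes of the Borel and projective hierarchies. *)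

theory Defs
  imports "HOL-Analysis.Analysis"
begin

type_synonym word = "bool list"
type_synonym omega_word = "nat \<Rightarrow> bool"

text \<open>
  Every prefix of length \<open>k + 1\<close> of the infinite concatenation of \<open>u 0, u 1, \<dots>\<close> is already
  determined by the first \<open>k + 1\<close> factors, provided that no factor is empty; the definition
  is meaningful only under this proviso.
\<close>

definition omega_concat :: "(nat \<Rightarrow> word) \<Rightarrow> omega_word" where
  "omega_concat u = (\<lambda>k. concat (map u [0..<Suc k]) ! k)"

lemma length_concat_nonempty:
  assumes "\<And>i. u i \<noteq> []"
  shows "n \<le> length (concat (map u [0..<n]))"
proof (induction n)
  case (Suc n)
  have "1 \<le> length (u n)"
    using assms[of n] by (simp add: Suc_le_eq)
  with Suc show ?case by simp
qed simp

lemma concat_upt_split: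
  "m \<le> n \<Longrightarrow> concat (map u [0..<n]) = concat (map u [0..<m]) @ concat (map u [m..<n])"
  using upt_add_eq_append[of 0 m "n - m"] by simp

lemma omega_concat_nth:
  assumes "\<And>i. u i \<noteq> []" and k: "k < length (concat (map u [0..<n]))"
  shows "omega_concat u k = concat (map u [0..<n]) ! k"
proof -
  have len: "k < length (concat (map u [0..<Suc k]))"
    using length_concat_nonempty[of u "Suc k"] assms(1) by simp
  show ?thesis
  proof (cases "n \<le> Suc k")
    case True
    show ?thesis
      unfolding omega_concat_def concat_upt_split[OF True, of u]
      using k by (simp only: nth_append if_True)
  next
    case False
    then have le: "Suc k \<le> n" by simp
    show ?thesis
      unfolding omega_concat_def concat_upt_split[OF le, of u]
      using len by (simp only: nth_append if_True)
  qed
qed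

lemma omega_concat_prefix:
  assumes "\<And>i. u i \<noteq> []"
  shows "map (omega_concat u) [0..<length (concat (map u [0..<n]))] = concat (map u [0..<n])"
  by (rule nth_equalityI) (simp_all add: omega_concat_nth[OF assms, where n = n] del: length_concat)

definition omega_power :: "word set \<Rightarrow> omega_word set" where
  "omega_power V = {omega_concat u | u. \<forall>i. u i \<in> V - {[]}}"

text \<open>
  Dictionaries, as points of the space \<open>2\<^bsup>2*\<^esup>\<close>, are predicates on words; the function type
  \<open>word \<Rightarrow> bool\<close> carries the product topology of the discrete topology on \<open>bool\<close>.
\<close>

definition dictionaries_omega_power_in :: "omega_word set set \<Rightarrow> (word \<Rightarrow> bool) set" where
  "dictionaries_omega_power_in \<Gamma> = {A. omega_power {w. A w} \<in> \<Gamma>}"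

text \<open>
  Boldface projective classes; the definitions are meant for Polish spaces. The existentially
  quantified coordinate ranges over the Baire space \<open>nat \<Rightarrow> nat\<close>.
\<close>

definition Sigma11 :: "'a::topological_space set \<Rightarrow> bool" where
  "Sigma11 A \<longleftrightarrow> (\<exists>C :: ('a \<times> (nat \<Rightarrow> nat)) set. closed C \<and> A = fst ` C)"

definition Pi11 :: "'a::topological_space set \<Rightarrow> bool" where
  "Pi11 A \<longleftrightarrow> Sigma11 (- A)"

definition Sigma12 :: "'a::topological_space set \<Rightarrow> bool" where
  "Sigma12 A \<longleftrightarrow> (\<exists>B :: ('a \<times> (nat \<Rightarrow> nat)) set. Pi11 B \<and> A = fst ` B)"

text \<open>The class of boldface \<open>\<Pi>\<^sup>0\<^sub>2\<close> sets is the library's \<^const>\<open>gdelta\<close>.\<close>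

end

theory Submission
  imports Defs
begin

text \<open>
  \<^emph>\<open>The upper bound.\<close> An omega-power \<open>A\<^sup>\<omega>\<close> is Borel if and only if it is the set \<open>D\<close> given by some Borel
  code. The quantifier over codes is existential, so it suffices that "the code is well-founded
  and codes \<open>A\<^sup>\<omega>\<close>" is a co-analytic condition on the code and \<open>A\<close>. Well-foundedness is co-analytic,
  and so is the inclusion of the analytic set \<open>A\<^sup>\<omega>\<close> in the Borel set \<open>D\<close>. The reverse inclusion, taken
  literally, is not of this form: the inclusion of a Borel set in an analytic set is
  a \<open>\<forall>\<exists>\<close>-statement, and for general analytic sets this obstacle is real. Omega-powers are
  special because \<open>A\<^sup>\<omega>\<close> is the largest set \<open>X\<close> such that every element of \<open>X\<close> begins with a
  nonempty word of \<open>A\<close> whose removal leaves an element of \<open>X\<close> (\<open>omega_power_coinduct\<close>).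
  Therefore \<open>D = A\<^sup>\<omega>\<close> can be tested by \<open>A\<^sup>\<omega> \<subseteq> D\<close> together with the condition that \<open>D\<close> is such an
  \<open>X\<close>, which is co-analytic again (\<open>borel_omega_power_iff_certificate\<close>).

  \<^emph>\<open>The lower bound.\<close> The set of all finite subsets of \<open>nat\<close> is not a \<open>\<Pi>\<^sup>0\<^sub>2\<close> set, and it is the
  preimage of the set of dictionaries in question under a continuous map \<open>search_dictionary\<close>.
  If \<open>S\<close> is finite, so is its dictionary, and the omega-power of a finite dictionary
  is closed. If \<open>S\<close> is infinite, the factorisations of a word that displays a labelled tree are the
  infinite branches of the tree, with \<open>S\<close> as the set of positions where nodes are displayed. So the
  set of ill-founded trees, which is not Borel by diagonalisation (\<open>ill_founded_not_borel\<close>), is a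
  continuous preimage of the omega-power.
\<close>

section \<open>Sequences over a discrete alphabet\<close>

lemma open_seq_iff:
  fixes U :: "(nat \<Rightarrow> 'b::discrete_topology) set"
  shows "open U \<longleftrightarrow> (\<forall>x\<in>U. \<exists>n. \<forall>y. (\<forall>i<n. y i = x i) \<longrightarrow> y \<in> U)"
proof
  assume U: "open U"
  show "\<forall>x\<in>U. \<exists>n. \<forall>y. (\<forall>i<n. y i = x i) \<longrightarrow> y \<in> U"
  proof
    fix x assume "x \<in> U"
    with U obtain X where x: "x \<in> Pi\<^sub>E UNIV X" and fin: "finite {i. X i \<noteq> UNIV}"
      and sub: "Pi\<^sub>E UNIV X \<subseteq> U"
      using product_topology_open_contains_basis[of "\<lambda>_. euclidean" UNIV U x]
      by (auto simp: open_fun_def)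
    obtain n where n: "\<And>i. X i \<noteq> UNIV \<Longrightarrow> i < n"
      using fin by (auto simp: finite_nat_set_iff_bounded)
    have "y \<in> U" if "\<forall>i<n. y i = x i" for y
    proof -
      have "y i \<in> X i" for i
        using that n[of i] x by (cases "i < n") auto
      then show ?thesis using sub by auto
    qed
    then show "\<exists>n. \<forall>y. (\<forall>i<n. y i = x i) \<longrightarrow> y \<in> U" by blast
  qed
next
  assume *: "\<forall>x\<in>U. \<exists>n. \<forall>y. (\<forall>i<n. y i = x i) \<longrightarrow> y \<in> U"
  show "open U"
    unfolding open_subopen[of U]
  proof
    fix x assume "x \<in> U"
    with * obtain n where n: "\<And>y. (\<forall>i<n. y i = x i) \<Longrightarrow> y \<in> U" by blast
    have "open {y. \<forall>i\<in>{..<n}. y (id i) \<in> {x i}}"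
      by (rule product_topology_basis') (auto intro: open_discrete)
    then show "\<exists>T. open T \<and> x \<in> T \<and> T \<subseteq> U"
      using n by (intro exI[of _ "{y. \<forall>i\<in>{..<n}. y (id i) \<in> {x i}}"]) auto
  qed
qed

lemma continuous_on_seq_local:
  fixes h :: "(nat \<Rightarrow> 'b::discrete_topology) \<Rightarrow> 'c \<Rightarrow> 'd::topological_space"
  assumes "\<And>x k. \<exists>n. \<forall>y. (\<forall>i<n. y i = x i) \<longrightarrow> h y k = h x k"
  shows "continuous_on UNIV h"
proof (rule continuous_on_coordinatewise_then_product)
  fix k
  show "continuous_on UNIV (\<lambda>x. h x k)"
    unfolding continuous_on_open_vimage[OF open_UNIV]
  proof (intro allI impI)
    fix B :: "'d set"
    show "open ((\<lambda>x. h x k) -` B \<inter> UNIV)"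
      unfolding open_seq_iff Int_UNIV_right
      using assms[of _ k] by (metis vimage_eq)
  qed
qed

section \<open>Closure properties of analytic sets\<close>

lemma continuous_on_regroup:
  fixes j :: "nat \<Rightarrow> nat"
  shows "continuous_on UNIV (\<lambda>p :: 'a::topological_space \<times> (nat \<Rightarrow> nat). (fst p, \<lambda>n. snd p (j n)))"
proof -
  have "continuous_on UNIV (\<lambda>p :: 'a \<times> (nat \<Rightarrow> nat). snd p (j n))" for n
    using continuous_on_compose2[OF continuous_on_product_coordinates continuous_on_snd[OF continuous_on_id]]
    by simp
  then show ?thesis
    by (intro continuous_on_Pair continuous_on_fst continuous_on_id
        continuous_on_coordinatewise_then_product)
qed

lemma closed_regroup:
  fixes C :: "('a::topological_space \<times> (nat \<Rightarrow> nat)) set" and j :: "nat \<Rightarrow> nat"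
  assumes "closed C"
  shows "closed {p. (fst p, \<lambda>n. snd p (j n)) \<in> C}"
  using closed_vimage[OF assms continuous_on_regroup[of j]] by (simp add: vimage_def)

lemma Sigma11_closed:
  assumes "closed A"
  shows "Sigma11 A"
  unfolding Sigma11_def
  by (rule exI[of _ "A \<times> UNIV"]) (use assms in \<open>auto intro: closed_Times simp: image_iff\<close>)

lemma Sigma11_Union:
  fixes A :: "nat \<Rightarrow> 'a::topological_space set"
  assumes "\<And>i::nat. Sigma11 (A i)"
  shows "Sigma11 (\<Union>i. A i)"
proof -
  have "\<forall>i. \<exists>C :: ('a \<times> (nat \<Rightarrow> nat)) set. closed C \<and> A i = fst ` C"
    using assms by (simp add: Sigma11_def)
  then obtain C :: "nat \<Rightarrow> ('a \<times> (nat \<Rightarrow> nat)) set"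
    where C: "\<And>i. closed (C i)" "\<And>i. A i = fst ` C i"
    by metis
  \<comment> \<open>The first entry of the witness selects the set, the others witness membership in it.\<close>
  define D where "D = (\<Inter>i. {p. snd p 0 \<noteq> i} \<union> {p. (fst p, \<lambda>n. snd p (Suc n)) \<in> C i})"
  have "closed {p :: 'a \<times> (nat \<Rightarrow> nat). snd p 0 \<noteq> i}" for i
  proof -
    have "continuous_on UNIV (\<lambda>p :: 'a \<times> (nat \<Rightarrow> nat). snd p 0)"
      using continuous_on_compose2[OF continuous_on_product_coordinates continuous_on_snd[OF continuous_on_id]]
      by simp
    moreover have "closed (- {i})" by (simp add: closed_def open_discrete)
    ultimately have "closed ((\<lambda>p :: 'a \<times> (nat \<Rightarrow> nat). snd p 0) -` (- {i}))"
      by (intro closed_vimage)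
    then show ?thesis by (simp add: vimage_def)
  qed
  then have "closed D"
    unfolding D_def by (intro closed_INT ballI closed_Un closed_regroup C)
  moreover have "(\<Union>i. A i) = fst ` D"
  proof (intro equalityI subsetI)
    fix a assume "a \<in> (\<Union>i. A i)"
    then obtain i z where "(a, z) \<in> C i" unfolding C(2) by auto
    then have "(a, case_nat i z) \<in> D" unfolding D_def by auto
    then show "a \<in> fst ` D" by force
  next
    fix a assume "a \<in> fst ` D"
    then obtain z where "(a, z) \<in> D" by auto
    then have "(a, \<lambda>n. z (Suc n)) \<in> C (z 0)" unfolding D_def by auto
    then show "a \<in> (\<Union>i. A i)" unfolding C(2) by force
  qed
  ultimately show ?thesis unfolding Sigma11_def by blast
qed

lemma Sigma11_Inter:
  fixes A :: "nat \<Rightarrow> 'a::topological_space set"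
  assumes "\<And>i::nat. Sigma11 (A i)"
  shows "Sigma11 (\<Inter>i. A i)"
proof -
  have "\<forall>i. \<exists>C :: ('a \<times> (nat \<Rightarrow> nat)) set. closed C \<and> A i = fst ` C"
    using assms by (simp add: Sigma11_def)
  then obtain C :: "nat \<Rightarrow> ('a \<times> (nat \<Rightarrow> nat)) set"
    where C: "\<And>i. closed (C i)" "\<And>i. A i = fst ` C i"
    by metis
  \<comment> \<open>One sequence carries a witness for each of the sets, in the rows of a matrix.\<close>
  define D where "D = (\<Inter>i. {p. (fst p, \<lambda>n. snd p (prod_encode (i, n))) \<in> C i})"
  have "closed D"
    unfolding D_def by (intro closed_INT ballI closed_regroup C)
  moreover have "(\<Inter>i. A i) = fst ` D"
  proof (intro equalityI subsetI)
    fix a assume "a \<in> (\<Inter>i. A i)"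
    then have "\<forall>i. \<exists>z. (a, z) \<in> C i" unfolding C(2) by fastforce
    then obtain z where "\<And>i. (a, z i) \<in> C i" by metis
    then have "(a, \<lambda>m. case prod_decode m of (i, n) \<Rightarrow> z i n) \<in> D" unfolding D_def by auto
    then show "a \<in> fst ` D" by force
  next
    fix a assume "a \<in> fst ` D"
    then show "a \<in> (\<Inter>i. A i)" unfolding C(2) D_def by force
  qed
  ultimately show ?thesis unfolding Sigma11_def by blast
qed

lemma Sigma11_Un:
  assumes "Sigma11 A" "Sigma11 B"
  shows "Sigma11 (A \<union> B)"
proof -
  have "A \<union> B = (\<Union>i::nat. if i = 0 then A else B)"
    by (auto split: if_splits)
  moreover have "Sigma11 (\<Union>i::nat. if i = 0 then A else B)"
    by (rule Sigma11_Union) (simp add: assms)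
  ultimately show ?thesis by simp
qed

lemma Sigma11_projection:
  fixes Q :: "('a::topological_space \<times> (nat \<Rightarrow> nat)) set"
  assumes "Sigma11 Q"
  shows "Sigma11 (fst ` Q)"
proof -
  obtain C :: "(('a \<times> (nat \<Rightarrow> nat)) \<times> (nat \<Rightarrow> nat)) set" where C: "closed C" "Q = fst ` C"
    using assms unfolding Sigma11_def by auto
  \<comment> \<open>The two quantified sequences are interleaved into one.\<close>
  define D where "D = {p :: 'a \<times> (nat \<Rightarrow> nat). ((fst p, \<lambda>n. snd p (2 * n)), \<lambda>n. snd p (2 * n + 1)) \<in> C}"
  have "continuous_on UNIV (\<lambda>p :: 'a \<times> (nat \<Rightarrow> nat). ((fst p, \<lambda>n. snd p (2 * n)), \<lambda>n. snd p (2 * n + 1)))"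
    by (intro continuous_on_Pair continuous_on_regroup
        continuous_on_snd[OF continuous_on_regroup, simplified])
  then have "closed D"
    unfolding D_def using closed_vimage[OF C(1)] by (simp add: vimage_def)
  moreover have "fst ` Q = fst ` D"
  proof (intro equalityI subsetI)
    fix a assume "a \<in> fst ` Q"
    then obtain y z where "((a, y), z) \<in> C" unfolding C(2) by auto
    then have "(a, \<lambda>m. if even m then y (m div 2) else z (m div 2)) \<in> D"
      unfolding D_def by simp
    then show "a \<in> fst ` D" by force
  next
    fix a assume "a \<in> fst ` D"
    then show "a \<in> fst ` Q" unfolding C(2) D_def by force
  qed
  ultimately show ?thesis unfolding Sigma11_def by blast
qed

lemma Sigma11_ex:
  assumes "Sigma11 {p :: 'a::topological_space \<times> (nat \<Rightarrow> nat). P (fst p) (snd p)}"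
  shows "Sigma11 {a. \<exists>z. P a z}"
proof -
  have "{a. \<exists>z. P a z} = fst ` {p. P (fst p) (snd p)}"
    by (auto simp: image_iff)
  then show ?thesis using Sigma11_projection[OF assms] by simp
qed

text \<open>
  Predicates that are built from discrete-valued coordinates by countable Boolean operations define
  members of the \<open>\<sigma>\<close>-algebra generated by the clopen sets. Clopen sets are analytic together with
  their complements, and this property is preserved by countable unions. In a zero-dimensional
  second countable space this is the Borel \<open>\<sigma>\<close>-algebra; clopen generators have the
  advantage that no open set has to be decomposed and no product of \<open>\<sigma>\<close>-algebras occurs.
\<close>

definition clopen_algebra :: "'a::topological_space measure" where
  "clopen_algebra = sigma UNIV {U. open U \<and> closed U}"

lemma space_clopen_algebra [simp]: "space clopen_algebra = UNIV"
  by (simp add: clopen_algebra_def space_measure_of_conv)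

lemma Sigma11_clopen_algebra:
  assumes "A \<in> sets clopen_algebra"
  shows "Sigma11 A"
proof -
  have "A \<in> sigma_sets UNIV {U. open U \<and> closed U}"
    using assms by (simp add: clopen_algebra_def)
  then have "Sigma11 A \<and> Sigma11 (- A)"
  proof induction
    case (Basic a)
    then show ?case by (auto intro!: Sigma11_closed simp: closed_def)
  next
    case Empty
    show ?case by (auto intro: Sigma11_closed)
  next
    case (Compl a)
    then show ?case by (simp add: Compl_eq_Diff_UNIV[symmetric])
  next
    case (Union a)
    then show ?case
      by (simp only: Compl_UN) (auto intro!: Sigma11_Union Sigma11_Inter)
  qed
  then show ?thesis ..
qed

lemma measurable_clopen_algebra:
  fixes h :: "'a::topological_space \<Rightarrow> 'b::discrete_topology"
  assumes "continuous_on UNIV h"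
  shows "h \<in> measurable clopen_algebra (count_space UNIV)"
proof (rule measurableI)
  fix A :: "'b set"
  have "open (h -` A)" "closed (h -` A)"
    using continuous_on_open_vimage[OF open_UNIV, of h] continuous_on_closed_vimage[OF closed_UNIV, of h] assms
    by (simp_all add: open_discrete closed_def)
  then show "h -` A \<inter> space clopen_algebra \<in> sets clopen_algebra"
    by (auto simp: clopen_algebra_def)
qed simp

lemma sets_borel_seq_bool:
  "sets (borel :: (nat \<Rightarrow> bool) measure) = sigma_sets UNIV (range (\<lambda>k. {x. x k}))"
proof (rule equalityI)
  interpret sigma_algebra UNIV "sigma_sets UNIV (range (\<lambda>k. {x :: nat \<Rightarrow> bool. x k}))"
    by (rule sigma_algebra_sigma_sets) simp
  let ?S = "sigma_sets UNIV (range (\<lambda>k. {x :: nat \<Rightarrow> bool. x k}))"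
  have cylinder: "{y. \<forall>i<n. y i = x i} \<in> ?S" for n and x :: "nat \<Rightarrow> bool"
  proof (induction n)
    case 0
    then show ?case using top by simp
  next
    case (Suc n)
    have "{y. y n} \<in> ?S" by auto
    then have "{y. y n = x n} \<in> ?S"
      using compl_sets[of "{y. y n}"] by (cases "x n") (simp_all add: Diff_eq Collect_neg_eq)
    moreover have "{y. \<forall>i<Suc n. y i = x i} = {y. \<forall>i<n. y i = x i} \<inter> {y. y n = x n}"
      by (auto simp: less_Suc_eq)
    ultimately show ?case using Suc by auto
  qed
  have "U \<in> ?S" if "open U" for U
  proof -
    let ?cyl = "\<lambda>l. {y. \<forall>i<length l. y i = l ! i}"
    have "U = (\<Union>l\<in>{l. ?cyl l \<subseteq> U}. ?cyl l)"
    proof (intro equalityI subsetI)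
      fix x assume "x \<in> U"
      with that obtain n where "\<forall>y. (\<forall>i<n. y i = x i) \<longrightarrow> y \<in> U"
        unfolding open_seq_iff by blast
      then show "x \<in> (\<Union>l\<in>{l. ?cyl l \<subseteq> U}. ?cyl l)"
        by (intro UN_I[of "map x [0..<n]"]) auto
    qed auto
    also have "\<dots> \<in> ?S"
      by (rule countable_UN'') (use cylinder in auto)
    finally show ?thesis .
  qed
  then have "sigma_sets UNIV {U. open U} \<subseteq> ?S"
    by (intro sigma_sets_mono) blast
  then show "sets (borel :: (nat \<Rightarrow> bool) measure) \<subseteq> ?S"
    unfolding borel_def by simp
next
  have "{x :: nat \<Rightarrow> bool. x k} \<in> sets borel" for k
  proof -
    have "open {x :: nat \<Rightarrow> bool. x k}"
      unfolding open_seq_iff by (metis lessI mem_Collect_eq)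
    then show ?thesis by simp
  qed
  then show "sigma_sets UNIV (range (\<lambda>k. {x. x k})) \<subseteq> sets (borel :: (nat \<Rightarrow> bool) measure)"
    using sets.sigma_sets_subset[of "range (\<lambda>k. {x :: nat \<Rightarrow> bool. x k})" borel] by auto
qed

lemma Sigma11_borel_seq_bool:
  assumes "A \<in> sets (borel :: (nat \<Rightarrow> bool) measure)"
  shows "Sigma11 A"
proof (rule Sigma11_clopen_algebra)
  have "{x :: nat \<Rightarrow> bool. x k} \<in> sets clopen_algebra" for k
    using measurable_sets[OF measurable_clopen_algebra[OF continuous_on_product_coordinates], of "{True}" k]
    by (simp add: vimage_def)
  then show "A \<in> sets clopen_algebra"
    using assms sets.sigma_sets_subset[of "range (\<lambda>k. {x :: nat \<Rightarrow> bool. x k})" clopen_algebra]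
    unfolding sets_borel_seq_bool by auto
qed

section \<open>Omega-powers\<close>

definition shift :: "nat \<Rightarrow> omega_word \<Rightarrow> omega_word" where
  "shift n x = (\<lambda>k. x (n + k))"

lemma shift_0 [simp]: "shift 0 x = x"
  by (simp add: shift_def)

lemma shift_shift [simp]: "shift m (shift n x) = shift (n + m) x"
  by (simp add: shift_def add.assoc)

lemma map_shift: "map (shift m x) [0..<n] = map x [m..<m + n]"
  by (rule nth_equalityI) (auto simp: shift_def)

lemma segment_append:
  assumes "l \<le> m" "m \<le> n"
  shows "map x [l..<m] @ map x [m..<n] = map x [l..<n]"
  using assms upt_add_eq_append[of l m "n - m"] by (simp flip: map_append)

lemma omega_concat_segment:
  assumes "\<And>i. u i \<noteq> []" "m \<le> n"
  shows "map (omega_concat u) [length (concat (map u [0..<m]))..<length (concat (map u [0..<n]))]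
       = concat (map u [m..<n])"
proof -
  let ?l = "\<lambda>n. length (concat (map u [0..<n]))"
  have "?l m \<le> ?l n"
    using concat_upt_split[OF assms(2), of u] by (metis length_append le_add1)
  then have "map (omega_concat u) [0..<?l m] @ map (omega_concat u) [?l m..<?l n]
      = map (omega_concat u) [0..<?l n]"
    by (intro segment_append) auto
  also have "\<dots> = concat (map u [0..<n])"
    by (rule omega_concat_prefix[OF assms(1)])
  also have "\<dots> = concat (map u [0..<m]) @ concat (map u [m..<n])"
    by (rule concat_upt_split[OF assms(2)])
  finally show ?thesis
    unfolding omega_concat_prefix[OF assms(1)] by (rule iffD1[OF same_append_eq])
qed

text \<open>
  A factorisation of an infinite word is determined by the strictly increasing sequence of its
  cut positions, a point of the Baire space; this exhibits omega-powers as analytic sets,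
  uniformly in the dictionary.
\<close>

lemma omega_power_iff_cuts:
  "x \<in> omega_power V \<longleftrightarrow>
    (\<exists>q. q 0 = 0 \<and> (\<forall>i. q i < q (Suc i) \<and> map x [q i..<q (Suc i)] \<in> V))"
proof
  assume "x \<in> omega_power V"
  then obtain u where x: "x = omega_concat u" and u: "\<And>i. u i \<in> V" "\<And>i. u i \<noteq> []"
    unfolding omega_power_def by blast
  define q where "q i = length (concat (map u [0..<i]))" for i
  have "map x [q i..<q (Suc i)] = u i" for i
    using omega_concat_segment[of u i "Suc i"] u(2) unfolding x q_def by simp
  moreover have "q i < q (Suc i)" for i
    using u(2) by (simp add: q_def)
  ultimately show "\<exists>q. q 0 = 0 \<and> (\<forall>i. q i < q (Suc i) \<and> map x [q i..<q (Suc i)] \<in> V)"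
    using u(1) by (intro exI[of _ q]) (simp add: q_def)
next
  assume "\<exists>q. q 0 = 0 \<and> (\<forall>i. q i < q (Suc i) \<and> map x [q i..<q (Suc i)] \<in> V)"
  then obtain q where q: "q 0 = 0" "\<And>i. q i < q (Suc i)" "\<And>i. map x [q i..<q (Suc i)] \<in> V"
    by blast
  define u where "u i = map x [q i..<q (Suc i)]" for i
  have ne: "u i \<noteq> []" for i using q(2)[of i] by (simp add: u_def)
  have concat: "concat (map u [0..<n]) = map x [0..<q n]" for n
  proof (induction n)
    case (Suc n)
    then show ?case
      using segment_append[of 0 "q n" "q (Suc n)" x] q(2)[of n] by (simp add: u_def)
  qed (simp add: q)
  have "omega_concat u k = x k" for k
  proof -
    have "strict_mono q" using q(2) by (simp add: strict_mono_Suc_iff)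
    then have "k < q (Suc k)"
      using strict_mono_imp_increasing[of q "Suc k"] by simp
    then show ?thesis
      using omega_concat_nth[of u k "Suc k"] ne unfolding concat by simp
  qed
  then have "x = omega_concat u" by auto
  moreover have "\<forall>i. u i \<in> V - {[]}" using q(3) ne by (simp add: u_def)
  ultimately show "x \<in> omega_power V" unfolding omega_power_def by blast
qed

lemma omega_power_unfold:
  assumes "x \<in> omega_power V"
  shows "\<exists>n>0. map x [0..<n] \<in> V \<and> shift n x \<in> omega_power V"
proof -
  obtain q where q: "q 0 = 0" "\<And>i. q i < q (Suc i)" "\<And>i. map x [q i..<q (Suc i)] \<in> V"
    using assms unfolding omega_power_iff_cuts by blast
  have mono: "q 1 \<le> q (Suc i)" for i
    by (rule lift_Suc_mono_le) (use q(2) in \<open>auto intro: less_imp_le\<close>)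
  have "map (shift (q 1) x) [q (Suc i) - q 1..<q (Suc (Suc i)) - q 1]
      = map x [q (Suc i)..<q (Suc (Suc i))]" for i
    using mono[of i] mono[of "Suc i"] by (intro nth_equalityI) (auto simp: shift_def)
  then have "map (shift (q 1) x) [q (Suc i) - q 1..<q (Suc (Suc i)) - q 1] \<in> V" for i
    using q(3) by simp
  moreover have "q (Suc i) - q 1 < q (Suc (Suc i)) - q 1" for i
    using q(2) mono by (intro diff_less_mono)
  ultimately have "shift (q 1) x \<in> omega_power V"
    unfolding omega_power_iff_cuts by (intro exI[of _ "\<lambda>i. q (Suc i) - q 1"]) simp
  moreover have "q 1 > 0" "map x [0..<q 1] \<in> V"
    using q(1) q(2,3)[of 0] by simp_all
  ultimately show ?thesis by blast
qed

text \<open>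
  First factors can be split off again and again, which yields a factorisation. Hence the omega-power
  is the largest set of infinite words each of which begins with a nonempty word of the dictionary
  whose removal leaves an element of the same set.
\<close>

lemma omega_power_coinduct:
  assumes "x \<in> D"
    and step: "\<And>x. x \<in> D \<Longrightarrow> \<exists>n>0. map x [0..<n] \<in> V \<and> shift n x \<in> D"
  shows "x \<in> omega_power V"
proof -
  obtain n where n: "\<And>x. x \<in> D \<Longrightarrow> n x > 0" "\<And>x. x \<in> D \<Longrightarrow> map x [0..<n x] \<in> V"
    "\<And>x. x \<in> D \<Longrightarrow> shift (n x) x \<in> D"
    using step by metis
  define q where "q = rec_nat 0 (\<lambda>_ m. m + n (shift m x))"
  have q: "q 0 = 0" "q (Suc i) = q i + n (shift (q i) x)" for i
    by (simp_all add: q_def)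
  have D: "shift (q i) x \<in> D" for i
  proof (induction i)
    case (Suc i)
    then show ?case using n(3)[OF Suc] by (simp add: q)
  qed (simp add: q assms(1))
  have "map x [q i..<q (Suc i)] \<in> V" "q i < q (Suc i)" for i
    using n(1,2)[OF D[of i]] by (simp_all add: q(2) map_shift)
  then show ?thesis
    unfolding omega_power_iff_cuts using q(1) by blast
qed

section \<open>Borel codes\<close>

text \<open>
  A labelling \<open>L\<close> of the nodes of the tree \<open>nat list\<close> codes a Borel set of infinite words: a node
  with label \<open>Suc k\<close> is a leaf and stands for the words with a letter \<open>True\<close> at position \<open>k\<close>, and
  a node with label \<open>0\<close> stands for the complement of the union of the sets at its children. This
  makes sense when the relation below, which leads from inner nodes to their children, is
  well-founded. Complement of union is the only operation needed, since complements and countable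
  unions are compositions of it.
\<close>

definition child_rel :: "(nat list \<Rightarrow> nat) \<Rightarrow> (nat list \<times> nat list) set" where
  "child_rel L = {(s @ [i], s) | s i. L s = 0}"

text \<open>
  \<open>E s\<close> is meant to be the truth value of membership of \<open>x\<close> in the set at node \<open>s\<close>. The local
  conditions determine it by well-founded recursion, but, unlike the recursion, they
  are arithmetical, so that they can be used in the calculation of projective classes.
\<close>

definition evaluation :: "(nat list \<Rightarrow> nat) \<Rightarrow> omega_word \<Rightarrow> (nat list \<Rightarrow> bool) \<Rightarrow> bool" where
  "evaluation L x E \<longleftrightarrow>
    (\<forall>s. E s = (case L s of 0 \<Rightarrow> \<forall>i. \<not> E (s @ [i]) | Suc k \<Rightarrow> x k))"

definition codes_set :: "(nat list \<Rightarrow> nat) \<Rightarrow> omega_word set \<Rightarrow> bool" where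
  "codes_set L D \<longleftrightarrow> wf (child_rel L) \<and> (\<forall>x E. evaluation L x E \<longrightarrow> (E [] \<longleftrightarrow> x \<in> D))"

lemma evaluationD:
  assumes "evaluation L x E"
  shows "E s = (case L s of 0 \<Rightarrow> \<forall>i. \<not> E (s @ [i]) | Suc k \<Rightarrow> x k)"
  using assms unfolding evaluation_def by (rule spec)

lemma evaluation_exists:
  assumes "wf (child_rel L)"
  shows "\<exists>E. evaluation L x E"
proof -
  define H where "H g s = (case L s of 0 \<Rightarrow> \<forall>i. \<not> g (s @ [i]) | Suc k \<Rightarrow> x k)" for g s
  let ?E = "wfrec (child_rel L) H"
  have "?E s = H ?E s" for s
  proof -
    have "?E s = H (cut ?E (child_rel L) s) s" by (rule wfrec[OF assms])
    also have "\<dots> = H ?E s"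
      unfolding H_def by (auto simp: cut_def child_rel_def split: nat.split)
    finally show ?thesis .
  qed
  then have "evaluation L x ?E" unfolding evaluation_def H_def by blast
  then show ?thesis by blast
qed

lemma borel_evaluation:
  assumes "wf (child_rel L)" and E: "\<And>x. evaluation L x (E x)"
  shows "{x. E x s} \<in> sets borel"
  using assms(1)
proof (induction s)
  case (less s)
  show ?case
  proof (cases "L s")
    case 0
    then have "{x. E x s} = (\<Inter>i. - {x. E x (s @ [i])})"
      by (auto simp: evaluationD[OF E, of _ s])
    moreover have "{x. E x (s @ [i])} \<in> sets borel" for i
      using less 0 by (auto simp: child_rel_def)
    ultimately show ?thesis
      by (auto intro!: sets.countable_INT simp: Compl_eq_Diff_UNIV)
  next
    case (Suc k)
    then have "{x. E x s} = {x. x k}"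
      by (auto simp: evaluationD[OF E, of _ s])
    then show ?thesis by (simp add: sets_borel_seq_bool sigma_sets.Basic)
  qed
qed

fun join_codes :: "(nat \<Rightarrow> nat list \<Rightarrow> nat) \<Rightarrow> nat list \<Rightarrow> nat" where
  "join_codes L [] = 0"
| "join_codes L (i # s) = L i s"

lemma codes_set_join:
  assumes "\<And>i. codes_set (L i) (D i)"
  shows "codes_set (join_codes L) (\<Inter>i. - D i)"
  unfolding codes_set_def
proof (intro conjI allI impI)
  have wf: "wf (child_rel (L i))" for i
    using assms unfolding codes_set_def by blast
  show "wf (child_rel (join_codes L))"
    unfolding wf_iff_no_infinite_down_chain
  proof
    assume "\<exists>f. \<forall>n. (f (Suc n), f n) \<in> child_rel (join_codes L)"
    then obtain f where f: "\<And>n. (f (Suc n), f n) \<in> child_rel (join_codes L)" by blast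
    obtain i t where it: "f 1 = i # t"
      using f[of 0] by (cases "f 0") (auto simp: child_rel_def)
    have "\<exists>t. f (Suc n) = i # t" for n
    proof (induction n)
      case (Suc n)
      then show ?case using f[of "Suc n"] by (auto simp: child_rel_def)
    qed (use it in simp)
    then obtain g where g: "\<And>n. f (Suc n) = i # g n" by metis
    have "(g (Suc n), g n) \<in> child_rel (L i)" for n
      using f[of "Suc n"] by (auto simp: child_rel_def g)
    then show False using wf[of i] unfolding wf_iff_no_infinite_down_chain by blast
  qed
next
  fix x E assume E: "evaluation (join_codes L) x E"
  have "evaluation (L i) x (\<lambda>s. E (i # s))" for i
    unfolding evaluation_def
  proof
    fix s
    show "E (i # s) = (case L i s of 0 \<Rightarrow> \<forall>j. \<not> E (i # s @ [j]) | Suc k \<Rightarrow> x k)"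
      by (cases "L i s") (simp_all add: evaluationD[OF E, of "i # s"])
  qed
  then have "E [i] \<longleftrightarrow> x \<in> D i" for i
    using assms[of i] unfolding codes_set_def by blast
  moreover have "E [] \<longleftrightarrow> (\<forall>i. \<not> E [i])"
    using evaluationD[OF E, of "[]"] by simp
  ultimately show "E [] \<longleftrightarrow> x \<in> (\<Inter>i. - D i)" by auto
qed

lemma borel_imp_code:
  assumes "D \<in> sets (borel :: omega_word measure)"
  shows "\<exists>L. codes_set L D"
proof -
  have compl: "\<exists>L. codes_set L (- D)" if "\<exists>L. codes_set L D" for D
    using that codes_set_join[of "\<lambda>_. _" "\<lambda>_. D"] by auto
  have "D \<in> sigma_sets UNIV (range (\<lambda>k. {x. x k}))"
    using assms by (simp add: sets_borel_seq_bool)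
  then show ?thesis
  proof induction
    case (Basic D)
    then obtain k where "D = {x. x k}" by auto
    then have "codes_set (\<lambda>_. Suc k) D"
      by (auto simp: codes_set_def child_rel_def evaluation_def)
    then show ?case by blast
  next
    case Empty
    let ?D = "{x :: omega_word. x 0}"
    have "codes_set (\<lambda>_. Suc 0) ?D"
      by (auto simp: codes_set_def child_rel_def evaluation_def)
    moreover from this obtain L where "codes_set L (- ?D)"
      using compl[of ?D] by blast
    ultimately have "codes_set (join_codes (\<lambda>i. if i = 0 then (\<lambda>_. Suc 0) else L))
        (\<Inter>i::nat. - (if i = 0 then ?D else - ?D))"
      by (intro codes_set_join) auto
    moreover have "(\<Inter>i::nat. - (if i = 0 then ?D else - ?D)) = {}"
    proof (rule equals0I)
      fix x assume x: "x \<in> (\<Inter>i::nat. - (if i = 0 then ?D else - ?D))"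
      have "x \<in> - ?D" using INT_D[OF x, of 0] by simp
      moreover have "x \<in> ?D" using INT_D[OF x, of 1] by simp
      ultimately show False by simp
    qed
    ultimately show ?case by auto
  next
    case (Compl D)
    then show ?case using compl by (simp add: Compl_eq_Diff_UNIV)
  next
    case (Union D)
    then obtain L where "\<And>i. codes_set (L i) (D i)" by metis
    then have "codes_set (join_codes L) (- (\<Union>i. D i))"
      using codes_set_join[of L D] by (simp add: Compl_UN)
    then show ?case using compl by (metis double_complement)
  qed
qed

section \<open>The upper bound\<close>

text \<open>
  A code certifies that the omega-power of \<open>A\<close> is the coded set \<open>D\<close> if the omega-power is contained
  in \<open>D\<close> and every member of \<open>D\<close> splits off a word of \<open>A\<close> and leaves a member of \<open>D\<close>. The second
  condition replaces the inclusion of \<open>D\<close> in the omega-power: to say that every member of \<open>D\<close> has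
  a factorisation would take a quantifier alternation over infinite sequences, whereas
  here the existential quantifier ranges over natural numbers. The family \<open>E\<close> evaluates the code at
  all tails of \<open>x\<close> at once, because the membership of a tail in \<open>D\<close> is needed in the conclusion.
\<close>

definition certifies :: "(nat list \<Rightarrow> nat) \<Rightarrow> (word \<Rightarrow> bool) \<Rightarrow> bool" where
  "certifies L A \<longleftrightarrow> wf (child_rel L) \<and>
    (\<forall>x E. (\<forall>n. evaluation L (shift n x) (E n)) \<longrightarrow>
      (x \<in> omega_power {w. A w} \<longrightarrow> E 0 []) \<and>
      (E 0 [] \<longrightarrow> (\<exists>n>0. A (map x [0..<n]) \<and> E n [])))"

lemma borel_omega_power_iff_certificate:
  "omega_power {w. A w} \<in> sets borel \<longleftrightarrow> (\<exists>L. certifies L A)"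
proof
  let ?V = "{w. A w}"
  assume "omega_power ?V \<in> sets borel"
  then obtain L where L: "codes_set L (omega_power ?V)"
    using borel_imp_code by blast
  have "certifies L A"
    unfolding certifies_def
  proof (intro conjI allI impI)
    show "wf (child_rel L)" using L by (simp add: codes_set_def)
  next
    fix x E assume "\<forall>n. evaluation L (shift n x) (E n)"
    then have E: "E n [] \<longleftrightarrow> shift n x \<in> omega_power ?V" for n
      using L unfolding codes_set_def by blast
    show "E 0 []" if "x \<in> omega_power ?V"
      using that E[of 0] by simp
    show "\<exists>n>0. A (map x [0..<n]) \<and> E n []" if "E 0 []"
      using that E omega_power_unfold[of x ?V] by auto
  qed
  then show "\<exists>L. certifies L A" by blast
next
  let ?V = "{w. A w}"
  assume "\<exists>L. certifies L A"
  then obtain L where L: "certifies L A" ..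
  then have wf: "wf (child_rel L)" by (simp add: certifies_def)
  then obtain E where E: "\<And>x. evaluation L x (E x)"
    using evaluation_exists by metis
  define D where "D = {x. E x []}"
  have "(x \<in> omega_power ?V \<longrightarrow> E (shift 0 x) []) \<and>
      (E (shift 0 x) [] \<longrightarrow> (\<exists>n>0. A (map x [0..<n]) \<and> E (shift n x) []))" for x
    using L E unfolding certifies_def by (elim conjE allE[of _ x] allE[of _ "\<lambda>n. E (shift n x)"]) simp
  then have 1: "x \<in> omega_power ?V \<Longrightarrow> x \<in> D"
    and 2: "x \<in> D \<Longrightarrow> \<exists>n>0. map x [0..<n] \<in> ?V \<and> shift n x \<in> D" for x
    by (simp_all add: D_def)
  have "omega_power ?V = D"
    using 1 omega_power_coinduct[OF _ 2] by blast
  then show "omega_power ?V \<in> sets borel"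
    using borel_evaluation[OF wf E] by (simp add: D_def)
qed

lemma segment_eq_iff:
  "map x [m..<n] = w \<longleftrightarrow> length w = n - m \<and> (\<forall>j<n - m. w ! j = x (m + j))"
  by (auto simp: list_eq_iff_nth_eq)

text \<open>
  The following predicates express that a code is not a certificate. Membership in an omega-power
  is written out, and compositions are resolved into quantifiers over natural numbers and words, so
  that every atom compares a single value of one of the sequences with a constant.
\<close>

definition infinite_descent_in :: "(nat \<Rightarrow> nat) \<Rightarrow> (nat \<Rightarrow> nat) \<Rightarrow> bool" where
  "infinite_descent_in T f \<longleftrightarrow>
    (\<forall>n. \<exists>l i. f n = list_encode l \<and> f (Suc n) = list_encode (l @ [i]) \<and> T (list_encode l) = 0)"

definition evaluates_tails :: "(nat \<Rightarrow> nat) \<Rightarrow> omega_word \<Rightarrow> (nat \<Rightarrow> nat list \<Rightarrow> bool) \<Rightarrow> bool" where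
  "evaluates_tails T x E \<longleftrightarrow>
    (\<forall>n s. (T (list_encode s) = 0 \<longrightarrow> (E n s \<longleftrightarrow> (\<forall>i. \<not> E n (s @ [i])))) \<and>
      (\<forall>k. T (list_encode s) = Suc k \<longrightarrow> (E n s \<longleftrightarrow> x (n + k))))"

definition cuts :: "(word \<Rightarrow> bool) \<Rightarrow> omega_word \<Rightarrow> (nat \<Rightarrow> nat) \<Rightarrow> bool" where
  "cuts A x q \<longleftrightarrow> q 0 = 0 \<and> (\<forall>i. \<exists>m n w. m < n \<and> q i = m \<and> q (Suc i) = n \<and>
    (length w = n - m \<and> (\<forall>j<n - m. w ! j = x (m + j))) \<and> A w)"

text \<open>
  The differences and sums with \<open>0\<close> keep the shape of \<open>segment_eq_iff\<close> for segments that start at \<open>0\<close>.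
\<close>

definition no_split :: "(word \<Rightarrow> bool) \<Rightarrow> omega_word \<Rightarrow> (nat \<Rightarrow> nat list \<Rightarrow> bool) \<Rightarrow> bool" where
  "no_split A x E \<longleftrightarrow>
    (\<forall>n>0. \<forall>w. (length w = n - 0 \<and> (\<forall>j<n - 0. w ! j = x (0 + j))) \<longrightarrow> A w \<longrightarrow> \<not> E n [])"

definition refutes :: "(word \<Rightarrow> bool) \<Rightarrow> (nat \<Rightarrow> nat) \<Rightarrow> omega_word \<Rightarrow> (nat \<Rightarrow> nat list \<Rightarrow> bool) \<Rightarrow>
    (nat \<Rightarrow> nat) \<Rightarrow> bool" where
  "refutes A T x E q \<longleftrightarrow>
    evaluates_tails T x E \<and> (cuts A x q \<and> \<not> E 0 [] \<or> E 0 [] \<and> no_split A x E)"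

lemma wf_child_rel_iff:
  "wf (child_rel (T \<circ> list_encode)) \<longleftrightarrow> \<not> (\<exists>f. infinite_descent_in T f)"
proof -
  have "(\<exists>f. infinite_descent_in T f) \<longleftrightarrow> (\<exists>g. \<forall>n. (g (Suc n), g n) \<in> child_rel (T \<circ> list_encode))"
  proof
    assume "\<exists>f. infinite_descent_in T f"
    then obtain f where f: "\<And>n. \<exists>l i. f n = list_encode l \<and> f (Suc n) = list_encode (l @ [i]) \<and>
        T (list_encode l) = 0"
      unfolding infinite_descent_in_def by blast
    have "(list_decode (f (Suc n)), list_decode (f n)) \<in> child_rel (T \<circ> list_encode)" for n
      using f[of n] by (auto simp: child_rel_def)
    then show "\<exists>g. \<forall>n. (g (Suc n), g n) \<in> child_rel (T \<circ> list_encode)"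
      by (intro exI[of _ "\<lambda>n. list_decode (f n)"]) blast
  next
    assume "\<exists>g. \<forall>n. (g (Suc n), g n) \<in> child_rel (T \<circ> list_encode)"
    then obtain g where g: "\<And>n. (g (Suc n), g n) \<in> child_rel (T \<circ> list_encode)" by blast
    have "infinite_descent_in T (\<lambda>n. list_encode (g n))"
      unfolding infinite_descent_in_def
    proof
      fix n
      obtain i where "g (Suc n) = g n @ [i]" "T (list_encode (g n)) = 0"
        using g[of n] by (auto simp: child_rel_def)
      then show "\<exists>l i. list_encode (g n) = list_encode l \<and>
          list_encode (g (Suc n)) = list_encode (l @ [i]) \<and> T (list_encode l) = 0"
        by (intro exI[of _ "g n"] exI[of _ i]) simp
    qed
    then show "\<exists>f. infinite_descent_in T f" by blast
  qed
  then show ?thesis unfolding wf_iff_no_infinite_down_chain by blast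
qed

lemma certifies_iff_not_refuted:
  "certifies (T \<circ> list_encode) A \<longleftrightarrow>
    \<not> ((\<exists>f. infinite_descent_in T f) \<or> (\<exists>x E q. refutes A T x E q))"
proof -
  have tails: "evaluates_tails T x E \<longleftrightarrow> (\<forall>n. evaluation (T \<circ> list_encode) (shift n x) (E n))" for x E
    unfolding evaluates_tails_def evaluation_def shift_def by (simp split: nat.split)
  have power: "(\<exists>q. cuts A x q) \<longleftrightarrow> x \<in> omega_power {w. A w}" for x
    unfolding omega_power_iff_cuts cuts_def segment_eq_iff[symmetric] by simp
  have split: "no_split A x E \<longleftrightarrow> \<not> (\<exists>n>0. A (map x [0..<n]) \<and> E n [])" for x E
    unfolding no_split_def segment_eq_iff[symmetric] by auto
  have refutes: "(\<exists>q. refutes A T x E q) \<longleftrightarrow>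
      (\<forall>n. evaluation (T \<circ> list_encode) (shift n x) (E n)) \<and>
      (x \<in> omega_power {w. A w} \<and> \<not> E 0 [] \<or>
       E 0 [] \<and> \<not> (\<exists>n>0. A (map x [0..<n]) \<and> E n []))" for x E
    unfolding refutes_def tails[symmetric] power[symmetric] split[symmetric] by blast
  have neg: "(\<forall>x E. V x E \<longrightarrow> (P x \<longrightarrow> e E) \<and> (e E \<longrightarrow> Q x E)) \<longleftrightarrow>
      \<not> (\<exists>x E. V x E \<and> (P x \<and> \<not> e E \<or> e E \<and> \<not> Q x E))"
    for V Q :: "omega_word \<Rightarrow> (nat \<Rightarrow> nat list \<Rightarrow> bool) \<Rightarrow> bool" and P e
    by blast
  show ?thesis
    unfolding certifies_def wf_child_rel_iff refutes de_Morgan_disj by (rule conj_cong[OF refl neg])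
qed

text \<open>
  Existential quantifiers over other kinds of sequences become quantifiers over the Baire space by
  reading a number as the truth value of its being \<open>0\<close>.
\<close>

lemma ex_seq_bool_iff: "(\<exists>x :: nat \<Rightarrow> bool. P x) \<longleftrightarrow> (\<exists>z :: nat \<Rightarrow> nat. P (\<lambda>n. z n = 0))"
proof
  assume "\<exists>x. P x"
  then obtain x where "P x" ..
  then show "\<exists>z :: nat \<Rightarrow> nat. P (\<lambda>n. z n = 0)"
    by (intro exI[of _ "\<lambda>n. if x n then 0 else 1"]) simp
qed blast

lemma ex_family_iff:
  "(\<exists>E :: nat \<Rightarrow> nat list \<Rightarrow> bool. P E) \<longleftrightarrow>
   (\<exists>z :: nat \<Rightarrow> nat. P (\<lambda>n s. z (prod_encode (n, list_encode s)) = 0))"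
proof
  assume "\<exists>E. P E"
  then obtain E where "P E" ..
  then show "\<exists>z :: nat \<Rightarrow> nat. P (\<lambda>n s. z (prod_encode (n, list_encode s)) = 0)"
    by (intro exI[of _ "\<lambda>m. case prod_decode m of (n, c) \<Rightarrow> if E n (list_decode c) then 0 else 1"])
      (simp add: if_split_eq1)
qed blast

lemma measurable_coordinate:
  fixes g :: "'a::topological_space \<Rightarrow> 'i \<Rightarrow> 'b::discrete_topology"
  assumes "continuous_on UNIV g"
  shows "(\<lambda>a. g a i) \<in> measurable clopen_algebra (count_space UNIV)"
  by (rule measurable_clopen_algebra[OF continuous_on_product_then_coordinatewise[OF assms]])

lemma Sigma11_pred:
  assumes "Measurable.pred clopen_algebra P"
  shows "Sigma11 {a. P a}"
  using assms by (intro Sigma11_clopen_algebra) (simp add: pred_def)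

lemma Sigma11_infinite_descent:
  "Sigma11 {p :: (word \<Rightarrow> bool) \<times> (nat \<Rightarrow> nat). \<exists>f. infinite_descent_in (snd p) f}"
proof (rule Sigma11_ex, rule Sigma11_pred)
  let ?M = "clopen_algebra :: (((word \<Rightarrow> bool) \<times> (nat \<Rightarrow> nat)) \<times> (nat \<Rightarrow> nat)) measure"
  have [measurable]: "(\<lambda>a. snd (fst a) n) \<in> measurable ?M (count_space UNIV)"
    "(\<lambda>a. snd a n) \<in> measurable ?M (count_space UNIV)" for n
    by (intro measurable_coordinate continuous_intros)+
  show "Measurable.pred ?M (\<lambda>a. infinite_descent_in (snd (fst a)) (snd a))"
    unfolding infinite_descent_in_def by measurable
qed

lemma Sigma11_refuted:
  "Sigma11 {p :: (word \<Rightarrow> bool) \<times> (nat \<Rightarrow> nat). \<exists>x E q. refutes (fst p) (snd p) x E q}"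
  unfolding ex_seq_bool_iff ex_family_iff
proof (rule Sigma11_ex, rule Sigma11_ex, rule Sigma11_ex, rule Sigma11_pred)
  let ?M = "clopen_algebra ::
    (((((word \<Rightarrow> bool) \<times> (nat \<Rightarrow> nat)) \<times> (nat \<Rightarrow> nat)) \<times> (nat \<Rightarrow> nat)) \<times> (nat \<Rightarrow> nat)) measure"
  have [measurable]: "(\<lambda>a. fst (fst (fst (fst a))) w) \<in> measurable ?M (count_space UNIV)"
    "(\<lambda>a. snd (fst (fst (fst a))) n) \<in> measurable ?M (count_space UNIV)"
    "(\<lambda>a. snd (fst (fst a)) n) \<in> measurable ?M (count_space UNIV)"
    "(\<lambda>a. snd (fst a) n) \<in> measurable ?M (count_space UNIV)"
    "(\<lambda>a. snd a n) \<in> measurable ?M (count_space UNIV)" for w n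
    by (intro measurable_coordinate continuous_intros)+
  let ?E = "\<lambda>a n s. snd (fst a) (prod_encode (n, list_encode s)) = 0"
  have [measurable]:
    "Measurable.pred ?M (\<lambda>a. evaluates_tails (snd (fst (fst (fst a)))) (\<lambda>n. snd (fst (fst a)) n = 0) (?E a))"
    unfolding evaluates_tails_def by measurable
  have [measurable]:
    "Measurable.pred ?M (\<lambda>a. cuts (fst (fst (fst (fst a)))) (\<lambda>n. snd (fst (fst a)) n = 0) (snd a))"
    unfolding cuts_def by measurable
  have [measurable]:
    "Measurable.pred ?M (\<lambda>a. no_split (fst (fst (fst (fst a)))) (\<lambda>n. snd (fst (fst a)) n = 0) (?E a))"
    unfolding no_split_def by measurable
  show "Measurable.pred ?M (\<lambda>a. refutes (fst (fst (fst (fst a)))) (snd (fst (fst (fst a))))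
      (\<lambda>n. snd (fst (fst a)) n = 0) (?E a) (snd a))"
    unfolding refutes_def by measurable
qed

lemma Sigma12_borel_omega_powers:
  "Sigma12 (dictionaries_omega_power_in (sets borel))"
proof -
  define B where "B = {p :: (word \<Rightarrow> bool) \<times> (nat \<Rightarrow> nat). certifies (snd p \<circ> list_encode) (fst p)}"
  have "- B = {p. \<exists>f. infinite_descent_in (snd p) f} \<union> {p. \<exists>x E q. refutes (fst p) (snd p) x E q}"
    unfolding B_def certifies_iff_not_refuted by blast
  then have "Pi11 B"
    unfolding Pi11_def by (simp add: Sigma11_Un Sigma11_infinite_descent Sigma11_refuted)
  moreover have "dictionaries_omega_power_in (sets borel) = fst ` B"
  proof -
    have "(\<exists>L. certifies L A) \<longleftrightarrow> (\<exists>T. certifies (T \<circ> list_encode) A)" for A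
    proof
      assume "\<exists>L. certifies L A"
      then obtain L where "certifies L A" ..
      then have "certifies ((L \<circ> list_decode) \<circ> list_encode) A" by (simp add: comp_def)
      then show "\<exists>T. certifies (T \<circ> list_encode) A" by (rule exI[of _ "L \<circ> list_decode"])
    qed blast
    then show ?thesis
      unfolding dictionaries_omega_power_in_def borel_omega_power_iff_certificate B_def
      by (auto simp: image_iff)
  qed
  ultimately show ?thesis unfolding Sigma12_def by blast
qed

section \<open>Finite dictionaries\<close>

lemma compact_imp_closed_seq:
  fixes K :: "(nat \<Rightarrow> 'b::discrete_topology) set"
  assumes "compact K"
  shows "closed K"
proof -
  have "Hausdorff_space (product_topology (\<lambda>_. euclidean :: 'b topology) (UNIV :: nat set))"
    unfolding Hausdorff_space_product_topology by (simp add: Hausdorff_space_def disjnt_def separation_t2)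
  then show ?thesis
    using compactin_imp_closedin[of euclidean K] assms by (simp add: euclidean_product_topology)
qed

lemma compact_bounded_seq: "compact {y :: nat \<Rightarrow> nat. \<forall>i. y i < N}"
proof -
  have "compactin (product_topology (\<lambda>_. euclidean) UNIV) (Pi\<^sub>E UNIV (\<lambda>_ :: nat. {..<N}))"
    unfolding compactin_PiE by (simp add: finite_imp_compact)
  then have "compact (Pi\<^sub>E (UNIV :: nat set) (\<lambda>_. {..<N}))"
    by (simp add: euclidean_product_topology)
  moreover have "Pi\<^sub>E (UNIV :: nat set) (\<lambda>_. {..<N}) = {y. \<forall>i. y i < N}"
    by (auto simp: PiE_iff)
  ultimately show ?thesis by simp
qed

lemma omega_concat_cong:
  assumes "\<And>i. i \<le> k \<Longrightarrow> u i = v i"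
  shows "omega_concat u k = omega_concat v k"
proof -
  have "map u [0..<Suc k] = map v [0..<Suc k]" using assms by auto
  then show ?thesis unfolding omega_concat_def by (simp only:)
qed

text \<open>
  The omega-power of a finite dictionary is a continuous image of a compact space of sequences of
  words.
\<close>

lemma closed_omega_power_finite:
  assumes "finite V"
  shows "closed (omega_power V)"
proof -
  obtain N and w :: "nat \<Rightarrow> word" where w: "V - {[]} = w ` {i. i < N}"
    using finite_imp_nat_seg_image_inj_on[of "V - {[]}"] assms by auto
  let ?h = "\<lambda>y :: nat \<Rightarrow> nat. omega_concat (\<lambda>i. w (y i))"
  have "continuous_on UNIV ?h"
  proof (rule continuous_on_seq_local)
    fix x k
    show "\<exists>n. \<forall>y. (\<forall>i<n. y i = x i) \<longrightarrow> ?h y k = ?h x k"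
      by (intro exI[of _ "Suc k"] allI impI omega_concat_cong) simp
  qed
  then have "compact (?h ` {y. \<forall>i. y i < N})"
    by (intro compact_continuous_image compact_bounded_seq) (rule continuous_on_subset, auto)
  moreover have "omega_power V = ?h ` {y. \<forall>i. y i < N}"
  proof (intro equalityI subsetI)
    fix x assume "x \<in> omega_power V"
    then obtain u where x: "x = omega_concat u" and "\<forall>i. u i \<in> V - {[]}"
      unfolding omega_power_def by blast
    then have "\<forall>i. \<exists>j<N. u i = w j" unfolding w by auto
    then obtain y where y: "\<And>i. y i < N" "\<And>i. u i = w (y i)" by metis
    then have "x = ?h y" unfolding x by presburger
    then show "x \<in> ?h ` {y. \<forall>i. y i < N}" using y(1) by blast
  next
    fix x assume "x \<in> ?h ` {y. \<forall>i. y i < N}"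
    then obtain y where "x = ?h y" "\<And>i. y i < N" by blast
    moreover from this(2) have "\<forall>i. w (y i) \<in> V - {[]}" unfolding w by blast
    ultimately show "x \<in> omega_power V"
      unfolding omega_power_def by blast
  qed
  ultimately show ?thesis using compact_imp_closed_seq by simp
qed

section \<open>Ill-founded trees\<close>

text \<open>
  The nodes of the tree \<open>nat list\<close> are numbered by \<open>list_encode\<close>, with the last entry in front:
  the children of node \<open>m\<close> are the numbers \<open>Suc (prod_encode (i, m))\<close>, all larger than \<open>m\<close>. The
  monotonicity will allow nodes to be visited by reading an infinite word from left to right.
\<close>

definition child :: "nat \<Rightarrow> nat \<Rightarrow> bool" where
  "child m n \<longleftrightarrow> (\<exists>i. n = Suc (prod_encode (i, m)))"

definition ill_founded :: "(nat \<Rightarrow> bool) set" where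
  "ill_founded = {t. \<exists>p. p 0 = 0 \<and> (\<forall>j. child (p j) (p (Suc j)) \<and> t (p (Suc j)))}"

lemma child_less: "child m n \<Longrightarrow> m < n"
  unfolding child_def using le_prod_encode_2 le_imp_less_Suc by blast

definition branch_node :: "(nat \<Rightarrow> nat) \<Rightarrow> nat \<Rightarrow> nat" where
  "branch_node y n = list_encode (rev (map y [0..<n]))"

lemma ill_founded_iff: "t \<in> ill_founded \<longleftrightarrow> (\<exists>y. \<forall>n. t (branch_node y (Suc n)))"
proof
  assume "t \<in> ill_founded"
  then obtain p where p: "p 0 = 0" "\<And>j. child (p j) (p (Suc j))" "\<And>j. t (p (Suc j))"
    unfolding ill_founded_def by blast
  obtain y where y: "\<And>j. p (Suc j) = Suc (prod_encode (y j, p j))"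
    using p(2) unfolding child_def by metis
  have "p n = branch_node y n" for n
    by (induction n) (simp_all add: p(1) y branch_node_def)
  then show "\<exists>y. \<forall>n. t (branch_node y (Suc n))" using p(3) by metis
next
  assume "\<exists>y. \<forall>n. t (branch_node y (Suc n))"
  then obtain y where y: "\<And>n. t (branch_node y (Suc n))" by blast
  have "child (branch_node y j) (branch_node y (Suc j))" for j
    unfolding child_def branch_node_def by simp
  moreover have "branch_node y 0 = 0" by (simp add: branch_node_def)
  ultimately show "t \<in> ill_founded" unfolding ill_founded_def using y by blast
qed

lemma closed_iff_cylinders:
  fixes C :: "((nat \<Rightarrow> bool) \<times> (nat \<Rightarrow> nat)) set"
  assumes "closed C"
  shows "(x, y) \<in> C \<longleftrightarrow>
    (\<forall>n. \<exists>x' y'. (x', y') \<in> C \<and> (\<forall>i\<le>n. x' i = x i) \<and> (\<forall>i\<le>n. y' i = y i))"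
proof
  assume *: "\<forall>n. \<exists>x' y'. (x', y') \<in> C \<and> (\<forall>i\<le>n. x' i = x i) \<and> (\<forall>i\<le>n. y' i = y i)"
  show "(x, y) \<in> C"
  proof (rule ccontr)
    assume "(x, y) \<notin> C"
    then obtain U V where UV: "open U" "open V" "x \<in> U" "y \<in> V" "U \<times> V \<subseteq> - C"
      using open_prod_elim[of "- C" "(x, y)"] assms by (metis ComplI SigmaD1 SigmaD2 open_Compl)
    obtain m n where m: "\<And>x'. (\<forall>i<m. x' i = x i) \<Longrightarrow> x' \<in> U"
      and n: "\<And>y'. (\<forall>i<n. y' i = y i) \<Longrightarrow> y' \<in> V"
      using UV(1-4) unfolding open_seq_iff by blast
    obtain x' y' where "(x', y') \<in> C" "\<forall>i\<le>max m n. x' i = x i" "\<forall>i\<le>max m n. y' i = y i"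
      using * by blast
    moreover from this have "x' \<in> U" "y' \<in> V" using m n by simp_all
    ultimately show False using UV(5) by auto
  qed
next
  assume "(x, y) \<in> C"
  then show "\<forall>n. \<exists>x' y'. (x', y') \<in> C \<and> (\<forall>i\<le>n. x' i = x i) \<and> (\<forall>i\<le>n. y' i = y i)"
    by (intro allI exI[of _ x] exI[of _ y]) simp
qed

text \<open>
  An infinite word \<open>x\<close> is read as a code of a closed set \<open>C\<close> of pairs: it tells for all prefixes of
  equal length whether the cylinder that they span meets \<open>C\<close>. The tree below belongs to the
  section of \<open>C\<close> at the point \<open>x\<close> itself. If the set of ill-founded trees were Borel, then the set of
  all \<open>x\<close> for which this tree is not ill-founded would be analytic, the projection of some \<open>C\<close>,
  and a code of \<open>C\<close> would yield Russell's contradiction.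
\<close>

definition diagonal_tree :: "(nat \<Rightarrow> bool) \<Rightarrow> nat \<Rightarrow> bool" where
  "diagonal_tree x m = x (to_nat (map x [0..<length (list_decode m)], list_decode m))"

lemma continuous_diagonal_tree: "continuous_on UNIV diagonal_tree"
proof (rule continuous_on_seq_local)
  fix x :: "nat \<Rightarrow> bool" and k
  let ?c = "to_nat (map x [0..<length (list_decode k)], list_decode k)"
  have "diagonal_tree y k = diagonal_tree x k"
    if y: "\<forall>i<max (length (list_decode k)) (Suc ?c). y i = x i" for y
  proof -
    have "map y [0..<length (list_decode k)] = map x [0..<length (list_decode k)]"
      using y by simp
    moreover have "y ?c = x ?c" by (rule y[rule_format]) (simp add: less_max_iff_disj)
    ultimately show ?thesis unfolding diagonal_tree_def by (simp only:)
  qed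
  then show "\<exists>n. \<forall>y. (\<forall>i<n. y i = x i) \<longrightarrow> diagonal_tree y k = diagonal_tree x k" by blast
qed

lemma ill_founded_not_borel: "ill_founded \<notin> sets borel"
proof
  assume "ill_founded \<in> sets borel"
  then have "diagonal_tree -` ill_founded \<inter> space borel \<in> sets borel"
    by (rule measurable_sets[OF borel_measurable_continuous_onI[OF continuous_diagonal_tree]])
  then have "- (diagonal_tree -` ill_founded) \<in> sets borel"
    by (simp only: borel_comp space_borel Int_UNIV_right)
  then have "Sigma11 (- (diagonal_tree -` ill_founded))"
    by (rule Sigma11_borel_seq_bool)
  then obtain C :: "((nat \<Rightarrow> bool) \<times> (nat \<Rightarrow> nat)) set"
    where C: "closed C" "- (diagonal_tree -` ill_founded) = fst ` C"
    unfolding Sigma11_def by blast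
  define meets where "meets u v \<longleftrightarrow> (\<exists>x' y'. (x', y') \<in> C \<and>
      map x' [0..<length u] = u \<and> map y' [0..<length v] = v)" for u :: "bool list" and v :: "nat list"
  define c where "c m = (case from_nat m of (u, v) \<Rightarrow> meets u (rev v))" for m
  have prefix_eq: "map f [0..<Suc n] = map g [0..<Suc n] \<longleftrightarrow> (\<forall>i\<le>n. f i = g i)"
    for f g :: "nat \<Rightarrow> 'b" and n
    by (auto simp: less_Suc_eq_le simp del: upt_Suc)
  have section_C: "(c, y) \<in> C \<longleftrightarrow> (\<forall>n. meets (map c [0..<Suc n]) (map y [0..<Suc n]))" for y
    unfolding meets_def length_map length_upt diff_zero prefix_eq
    by (rule closed_iff_cylinders[OF C(1)])
  have "c \<in> fst ` C \<longleftrightarrow> (\<exists>y. (c, y) \<in> C)"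
    unfolding Domain_fst[symmetric] Domain_iff by (rule refl)
  also have "\<dots> \<longleftrightarrow> (\<exists>y. \<forall>n. meets (map c [0..<Suc n]) (map y [0..<Suc n]))"
    by (simp only: section_C)
  also have "\<dots> \<longleftrightarrow> (\<exists>y. \<forall>n. diagonal_tree c (branch_node y (Suc n)))"
    by (simp add: diagonal_tree_def branch_node_def c_def del: upt_Suc)
  also have "\<dots> \<longleftrightarrow> c \<in> diagonal_tree -` ill_founded"
    by (simp add: ill_founded_iff)
  finally show False using C(2) by blast
qed

section \<open>Dictionaries that search a tree\<close>

text \<open>
  The infinite word \<open>unroll b\<close> displays the values \<open>b 1, b 2, \<dots>\<close> one after the other, separated
  by the markers \<open>0\<^sup>k 1\<close>, which make the position inside the word recognisable. Block \<open>k\<close> starts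
  with the marker of \<open>k\<close> and ends with the letter \<open>b (Suc k)\<close>, so that a factor which leads from the
  front of the marker of \<open>k\<close> to the front of the marker of \<open>k'\<close> ends with the letter \<open>b k'\<close>.
\<close>

definition block :: "(nat \<Rightarrow> bool) \<Rightarrow> nat \<Rightarrow> word" where
  "block b k = replicate k False @ [True, b (Suc k)]"

definition unroll :: "(nat \<Rightarrow> bool) \<Rightarrow> omega_word" where
  "unroll b = omega_concat (block b)"

definition block_start :: "nat \<Rightarrow> nat" where
  "block_start k = (\<Sum>j<k. j + 2)"

lemma block_start_0 [simp]: "block_start 0 = 0"
  by (simp add: block_start_def)

lemma block_start_Suc: "block_start (Suc k) = block_start k + k + 2"
  by (simp add: block_start_def)

lemma block_start_strict_mono: "strict_mono block_start"
  by (simp add: strict_mono_Suc_iff block_start_Suc)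

lemma length_blocks: "length (concat (map (block b) [0..<k])) = block_start k"
  by (induction k) (simp_all add: block_start_Suc block_def)

lemma unroll_segment:
  assumes "m \<le> n"
  shows "map (unroll b) [block_start m..<block_start n] = concat (map (block b) [m..<n])"
  using omega_concat_segment[of "block b" m n] assms
  unfolding unroll_def length_blocks by (simp add: block_def)

lemma unroll_block:
  shows unroll_marker: "j < k \<Longrightarrow> \<not> unroll b (block_start k + j)"
    and unroll_marker_end: "unroll b (block_start k + k)"
    and unroll_value: "unroll b (block_start k + k + 1) = b (Suc k)"
proof -
  have *: "map (unroll b) [block_start k..<block_start (Suc k)] = block b k"
    using unroll_segment[of k "Suc k" b] by simp
  have "unroll b (block_start k + j) = block b k ! j" if "j < k + 2" for j
    using that arg_cong[OF *, of "\<lambda>w. w ! j"] by (simp add: block_start_Suc del: upt_Suc)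
  from this[of j] this[of k] this[of "k + 1"]
  show "j < k \<Longrightarrow> \<not> unroll b (block_start k + j)" "unroll b (block_start k + k)"
    "unroll b (block_start k + k + 1) = b (Suc k)"
    by (simp_all add: block_def nth_append)
qed

lemma unroll_value': "0 < k \<Longrightarrow> unroll b (block_start k - 1) = b k"
  using unroll_value[of b "k - 1"] block_start_Suc[of "k - 1"] by simp

text \<open>
  The marker at the front of a factor tells where the factor starts; its length is then
  determined by the marker at which it ends.
\<close>

lemma unroll_parse:
  assumes eq: "map (unroll b) [block_start m..<n] = concat (map (block b') [k..<k'])" and "k < k'"
  shows "k = m" "n = block_start k'" "b k' = b' k'"
proof -
  have eq': "map (unroll b) [block_start m..<n] = map (unroll b') [block_start k..<block_start k']"
    using eq unroll_segment[of k k' b'] assms(2) by simp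
  have len: "n - block_start m = block_start k' - block_start k"
    using arg_cong[OF eq', of length] by simp
  have "block_start (Suc k) \<le> block_start k'"
    using assms(2) by (simp add: strict_mono_less_eq[OF block_start_strict_mono])
  then have long: "block_start k + k + 2 \<le> block_start k'" by (simp add: block_start_Suc)
  have short: "k < block_start k' - block_start k" using long by simp
  have letter: "unroll b (block_start m + j) = unroll b' (block_start k + j)" if "j < block_start k' - block_start k" for j
    using arg_cong[OF eq', of "\<lambda>w. w ! j"] that len by simp
  show "k = m"
  proof (cases k m rule: linorder_cases)
    case less
    then show ?thesis
      using letter[OF short] unroll_marker[of k m b] unroll_marker_end[of b' k] by simp
  next
    case greater
    then show ?thesis
      using letter[of m] short unroll_marker[of m k b'] unroll_marker_end[of b m] by simp
  qed
  then show "n = block_start k'" using len long by simp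
  have "unroll b (block_start k' - 1) = unroll b' (block_start k' - 1)"
    using letter[of "block_start k' - 1 - block_start k"] long \<open>k = m\<close> by simp
  then show "b k' = b' k'" using assms(2) by (simp only: unroll_value'[of k'])
qed

text \<open>
  A set \<open>S\<close> of numbers, to which \<open>0\<close> is always added, serves as a copy of the set of nodes of the
  tree: its element of rank \<open>n\<close> stands for the node \<open>n\<close>. The words of the dictionary lead from an
  element of \<open>S\<close> to one of its children and demand that the child is marked by \<open>True\<close>. Every
  infinite \<open>S\<close> gives a full copy of the tree, whereas a finite \<open>S\<close> leaves only finitely many words.
\<close>

definition is_node :: "(nat \<Rightarrow> bool) \<Rightarrow> nat \<Rightarrow> bool" where
  "is_node S k \<longleftrightarrow> k = 0 \<or> S k"

definition node_rank :: "(nat \<Rightarrow> bool) \<Rightarrow> nat \<Rightarrow> nat" where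
  "node_rank S k = card {i. i < k \<and> is_node S i}"

definition search_dictionary :: "(nat \<Rightarrow> bool) \<Rightarrow> word \<Rightarrow> bool" where
  "search_dictionary S w \<longleftrightarrow> (\<exists>k k' b. k < k' \<and> is_node S k \<and> is_node S k' \<and>
    child (node_rank S k) (node_rank S k') \<and> b k' \<and> w = concat (map (block b) [k..<k']))"

lemma node_rank_le: "node_rank S k \<le> k"
proof -
  have "node_rank S k \<le> card {..<k}"
    unfolding node_rank_def by (rule card_mono) auto
  then show ?thesis by simp
qed

lemma length_blocks_between:
  assumes "k \<le> k'"
  shows "length (concat (map (block b) [k..<k'])) = block_start k' - block_start k"
  using arg_cong[OF unroll_segment[OF assms, of b], of length] by simp

lemma search_dictionary_cong:
  assumes "\<And>i. i < length w \<Longrightarrow> S i = S' i"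
  shows "search_dictionary S w = search_dictionary S' w"
proof -
  have imp: "search_dictionary T' w" if T: "search_dictionary T w" and eq: "\<And>i. i < length w \<Longrightarrow> T i = T' i" for T T'
  proof -
    obtain k k' b where *: "k < k'" "is_node T k" "is_node T k'"
      "child (node_rank T k) (node_rank T k')" "b k'" "w = concat (map (block b) [k..<k'])"
      using T unfolding search_dictionary_def by (elim exE conjE) (rule that)
    have "block_start k + k' + 1 \<le> block_start k'"
    proof -
      obtain j where "k' = Suc j" using *(1) by (cases k') auto
      then show ?thesis
        using *(1) strict_mono_less_eq[OF block_start_strict_mono, of k j] by (simp add: block_start_Suc)
    qed
    then have "k' < length w"
      using *(1,6) length_blocks_between[of k k' b] by simp
    then have node: "is_node T' i = is_node T i" if "i \<le> k'" for i
      using eq that by (simp add: is_node_def)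
    have node_rank: "node_rank T' i = node_rank T i" if "i \<le> k'" for i
    proof -
      have "{j. j < i \<and> is_node T' j} = {j. j < i \<and> is_node T j}"
        using node that by auto
      then show ?thesis by (simp add: node_rank_def)
    qed
    have "is_node T' k" "is_node T' k'" "child (node_rank T' k) (node_rank T' k')"
      using *(1-4) node[of k] node[of k'] node_rank[of k] node_rank[of k'] by simp_all
    then show ?thesis
      unfolding search_dictionary_def using *(1,5,6)
      by (intro exI[of _ k] exI[of _ k'] exI[of _ b] conjI)
  qed
  show ?thesis
  proof
    show "search_dictionary S w \<Longrightarrow> search_dictionary S' w" by (rule imp[of S S']) (simp_all add: assms)
    show "search_dictionary S' w \<Longrightarrow> search_dictionary S w" by (rule imp[of S' S]) (simp_all add: assms)
  qed
qed

lemma continuous_search_dictionary: "continuous_on UNIV search_dictionary"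
proof (rule continuous_on_seq_local)
  fix S w
  show "\<exists>n. \<forall>S'. (\<forall>i<n. S' i = S i) \<longrightarrow> search_dictionary S' w = search_dictionary S w"
    by (intro exI[of _ "length w"] allI impI search_dictionary_cong) simp
qed

lemma finite_search_dictionary:
  assumes "finite {k. S k}"
  shows "finite {w. search_dictionary S w}"
proof -
  have "finite {k. is_node S k}"
    using assms by (simp add: is_node_def Collect_disj_eq)
  then obtain M where M: "\<And>k. is_node S k \<Longrightarrow> k \<le> M"
    by (auto simp: finite_nat_set_iff_bounded_le)
  have "{w. search_dictionary S w} \<subseteq> {w. set w \<subseteq> UNIV \<and> length w \<le> block_start M}"
  proof
    fix w assume "w \<in> {w. search_dictionary S w}"
    then obtain k k' b where *: "k < k'" "is_node S k'" "w = concat (map (block b) [k..<k'])"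
      unfolding search_dictionary_def by blast
    then have "length w = block_start k' - block_start k"
      using length_blocks_between[of k k' b] by simp
    moreover have "block_start k' \<le> block_start M"
      using M[OF *(2)] by (simp add: strict_mono_less_eq[OF block_start_strict_mono])
    ultimately show "w \<in> {w. set w \<subseteq> UNIV \<and> length w \<le> block_start M}" by simp
  qed
  then show ?thesis
    by (rule finite_subset) (rule finite_lists_length_le, simp)
qed

text \<open>
  A factorisation of the unrolled tree can only cut in front of markers of nodes, and the ends of its
  factors say that these nodes form an infinite branch of marked nodes; conversely such a branch can be
  followed through the word from left to right, since children have larger numbers than their parents.
\<close>

lemma unroll_in_search_power_iff:
  assumes "infinite {k. S k}"
  shows "unroll (\<lambda>k. t (node_rank S k)) \<in> omega_power {w. search_dictionary S w} \<longleftrightarrow> t \<in> ill_founded"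
proof
  let ?b = "\<lambda>k. t (node_rank S k)"
  assume "t \<in> ill_founded"
  then obtain p where p: "p 0 = 0" "\<And>j. child (p j) (p (Suc j))" "\<And>j. t (p (Suc j))"
    unfolding ill_founded_def by blast
  define e where "e = enumerate {k. is_node S k}"
  have inf: "infinite {k. is_node S k}"
    using assms by (simp add: is_node_def Collect_disj_eq)
  have e_mono: "e m < e n \<longleftrightarrow> m < n" for m n
    unfolding e_def by (rule enumerate_mono_iff[OF inf])
  have e_node: "is_node S (e n)" for n
    using enumerate_in_set[OF inf, of n] unfolding e_def by simp
  have e_rank: "node_rank S (e n) = n" for n
  proof -
    have "{i. i < e n \<and> is_node S i} = e ` {..<n}"
    proof (intro equalityI subsetI)
      fix i assume i: "i \<in> {i. i < e n \<and> is_node S i}"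
      then obtain m where "i = e m"
        using enumerate_Ex[of "{k. is_node S k}" i] inf unfolding e_def by auto
      then show "i \<in> e ` {..<n}" using i e_mono by auto
    qed (auto simp: e_mono e_node)
    moreover have "inj e"
      using e_mono by (metis injI linorder_neq_iff)
    ultimately show ?thesis
      unfolding node_rank_def by (simp add: card_image inj_on_subset)
  qed
  have e_0: "e 0 = 0"
    unfolding e_def enumerate_0 by (rule Least_equality) (simp_all add: is_node_def)
  have "search_dictionary S (map (unroll ?b) [block_start (e (p i))..<block_start (e (p (Suc i)))])" for i
  proof -
    have "e (p i) < e (p (Suc i))"
      using child_less[OF p(2)] e_mono by blast
    then show ?thesis
      unfolding search_dictionary_def using p(2,3) e_node e_rank
      by (intro exI[of _ "e (p i)"] exI[of _ "e (p (Suc i))"] exI[of _ ?b]) (simp add: unroll_segment)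
  qed
  moreover have "block_start (e (p i)) < block_start (e (p (Suc i)))" for i
    using child_less[OF p(2)[of i]] by (simp add: strict_mono_less[OF block_start_strict_mono] e_mono)
  ultimately show "unroll ?b \<in> omega_power {w. search_dictionary S w}"
    unfolding omega_power_iff_cuts
    by (intro exI[of _ "\<lambda>i. block_start (e (p i))"]) (simp add: p(1) e_0)
next
  let ?b = "\<lambda>k. t (node_rank S k)"
  assume "unroll ?b \<in> omega_power {w. search_dictionary S w}"
  then obtain q where q: "q 0 = 0" "\<And>i. search_dictionary S (map (unroll ?b) [q i..<q (Suc i)])"
    unfolding omega_power_iff_cuts by blast
  obtain k k' b where less: "\<And>i. k i < k' i"
    and child: "\<And>i. child (node_rank S (k i)) (node_rank S (k' i))" and marked: "\<And>i. b i (k' i)"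
    and word: "\<And>i. map (unroll ?b) [q i..<q (Suc i)] = concat (map (block (b i)) [k i..<k' i])"
    using q(2) unfolding search_dictionary_def by metis
  have step: "k i = m" "q (Suc i) = block_start (k' i)" "t (node_rank S (k' i))" if "q i = block_start m" for i m
    using unroll_parse[OF word[of i, unfolded that] less] marked[of i] by auto
  have start: "k 0 = 0" using step(1)[of 0 0] q(1) by simp
  have q_pos: "q i = block_start (k i)" for i
  proof (induction i)
    case (Suc i)
    then show ?case using step(2)[OF Suc] step(1)[of "Suc i" "k' i"] by simp
  qed (simp add: q(1) start)
  have chain: "k (Suc i) = k' i" for i
    using step(1)[OF step(2)[OF q_pos]] .
  show "t \<in> ill_founded"
    unfolding ill_founded_def
  proof (intro CollectI exI[of _ "\<lambda>i. node_rank S (k i)"] conjI allI)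
    show "node_rank S (k 0) = 0" by (simp add: start node_rank_def)
    show "child (node_rank S (k j)) (node_rank S (k (Suc j)))" for j
      using child[of j] by (simp add: chain)
    show "t (node_rank S (k (Suc j)))" for j
      using step(3)[OF q_pos] by (simp add: chain)
  qed
qed

lemma continuous_unroll_node_rank: "continuous_on UNIV (\<lambda>t. unroll (\<lambda>k. t (node_rank S k)))"
proof (rule continuous_on_seq_local)
  fix x :: "nat \<Rightarrow> bool" and k
  have "unroll (\<lambda>k. y (node_rank S k)) k = unroll (\<lambda>k. x (node_rank S k)) k" if y: "\<forall>i<k + 2. y i = x i" for y
    unfolding unroll_def
  proof (rule omega_concat_cong)
    fix i assume "i \<le> k"
    then have "node_rank S (Suc i) < k + 2" using node_rank_le[of S "Suc i"] by simp
    then show "block (\<lambda>k. y (node_rank S k)) i = block (\<lambda>k. x (node_rank S k)) i"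
      using y by (simp add: block_def)
  qed
  then show "\<exists>n. \<forall>y. (\<forall>i<n. y i = x i) \<longrightarrow>
      unroll (\<lambda>k. y (node_rank S k)) k = unroll (\<lambda>k. x (node_rank S k)) k" by blast
qed

lemma borel_search_power_iff:
  "omega_power {w. search_dictionary S w} \<in> sets borel \<longleftrightarrow> finite {k. S k}"
proof
  assume "finite {k. S k}"
  then show "omega_power {w. search_dictionary S w} \<in> sets borel"
    by (intro borel_closed closed_omega_power_finite finite_search_dictionary)
next
  let ?g = "\<lambda>t. unroll (\<lambda>k. t (node_rank S k))"
  assume borel: "omega_power {w. search_dictionary S w} \<in> sets borel"
  show "finite {k. S k}"
  proof (rule ccontr)
    assume inf: "infinite {k. S k}"
    have "?g -` omega_power {w. search_dictionary S w} \<inter> space borel \<in> sets borel"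
      by (rule measurable_sets[OF borel_measurable_continuous_onI[OF continuous_unroll_node_rank] borel])
    moreover have "?g -` omega_power {w. search_dictionary S w} \<inter> space borel = ill_founded"
      using unroll_in_search_power_iff[OF inf] by auto
    ultimately show False using ill_founded_not_borel by simp
  qed
qed

section \<open>The lower bound\<close>

text \<open>
  Finite sets can be extended one element at a time so as to enter one open set after the other,
  for each of the open sets looks only at an initial segment. The union of the extensions lies in
  all the open sets and is infinite.
\<close>

lemma finite_sets_not_gdelta: "\<not> gdelta {S :: nat \<Rightarrow> bool. finite {k. S k}}"
proof
  assume "gdelta {S :: nat \<Rightarrow> bool. finite {k. S k}}"
  then obtain V where V: "\<And>n::nat. open (V n)" and eq: "{S :: nat \<Rightarrow> bool. finite {k. S k}} = (\<Inter>n. V n)"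
    unfolding gdelta.simps by auto
  define extends where "extends n F m \<longleftrightarrow>
    (\<forall>i\<in>F. i < m) \<and> (\<forall>S. (\<forall>i<m. S i = (i \<in> F)) \<longrightarrow> S \<in> V n)" for n m and F :: "nat set"
  have next_element: "\<exists>m. extends n F m" if "finite F" for F n
  proof -
    have "(\<lambda>i. i \<in> F) \<in> {S. finite {k. S k}}" using that by simp
    then have "(\<lambda>i. i \<in> F) \<in> V n" unfolding eq by blast
    with V[of n] have "\<exists>l. \<forall>S. (\<forall>i<l. S i = (i \<in> F)) \<longrightarrow> S \<in> V n"
      unfolding open_seq_iff by (rule bspec)
    then obtain l where l: "\<forall>S. (\<forall>i<l. S i = (i \<in> F)) \<longrightarrow> S \<in> V n" ..
    obtain l' where "\<forall>i\<in>F. i < l'"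
      using \<open>finite F\<close> by (auto simp: finite_nat_set_iff_bounded)
    then have "extends n F (max l l')"
      unfolding extends_def using l by (simp add: less_max_iff_disj)
    then show ?thesis ..
  qed
  have "\<exists>F. \<forall>n. finite (F n) \<and> (\<exists>m. F (Suc n) = insert m (F n) \<and> extends n (F n) m)"
  proof (rule dependent_nat_choice)
    show "\<exists>F :: nat set. finite F" by blast
  next
    fix F n assume F: "finite (F :: nat set)"
    then obtain m where "extends n F m"
      using next_element[of F n] by blast
    with F show "\<exists>F'. finite F' \<and> (\<exists>m. F' = insert m F \<and> extends n F m)"
      by (intro exI[of _ "insert m F"]) blast
  qed
  then obtain F where "\<forall>n. \<exists>m. F (Suc n) = insert m (F n) \<and> extends n (F n) m"
    by blast
  then obtain m where m: "\<forall>n. F (Suc n) = insert (m n) (F n) \<and> extends n (F n) (m n)"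
    by (rule choice[THEN exE])
  then have F_Suc: "F (Suc n) = insert (m n) (F n)" and new: "i \<in> F n \<Longrightarrow> i < m n"
    and enter: "(\<forall>i<m n. S i = (i \<in> F n)) \<Longrightarrow> S \<in> V n" for n i S
    unfolding extends_def by simp_all
  have F_mono: "F l \<subseteq> F n" if "l \<le> n" for l n
    using that by (rule lift_Suc_mono_le[of F, rotated]) (auto simp: F_Suc)
  have m_mono: "m l < m n" if "l < n" for l n
    using F_mono[of "Suc l" n] that new[of "m l" n] by (auto simp: F_Suc)
  have F_initial: "i \<in> F n" if "i \<in> F (n + d)" "i < m n" for i n d
    using that(1)
  proof (induction d)
    case (Suc d)
    have "m n \<le> m (n + d)" using m_mono[of n "n + d"] by (cases d) auto
    then show ?case using Suc that(2) by (auto simp: F_Suc)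
  qed simp
  define S where "S i \<longleftrightarrow> (\<exists>n. i \<in> F n)" for i
  have "i \<in> F n" if "S i" and less: "i < m n" for i n
  proof -
    obtain l where "i \<in> F l" using \<open>S i\<close> unfolding S_def by blast
    then have "i \<in> F (n + l)" using F_mono[of l "n + l"] by auto
    then show ?thesis using less by (rule F_initial)
  qed
  then have "S i = (i \<in> F n)" if "i < m n" for i n
    using that unfolding S_def by blast
  then have "S \<in> V n" for n by (intro enter) blast
  then have "finite {k. S k}" using eq by blast
  moreover have "range m \<subseteq> {k. S k}"
    unfolding S_def using F_Suc by blast
  moreover have "inj m"
    by (metis injI linorder_neq_iff m_mono)
  ultimately show False
    by (metis finite_subset range_inj_infinite)
qed

lemma gdelta_vimage:
  assumes "continuous_on UNIV f" "gdelta A"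
  shows "gdelta (f -` A)"
proof -
  obtain U where U: "\<And>n::nat. open (U n)" "A = (\<Inter>n. U n)"
    using assms(2) by (auto elim: gdelta.cases)
  have "f -` A = (\<Inter>n. f -` U n)" using U(2) by auto
  moreover have "gdelta (\<Inter>n. f -` U n)"
    by (intro gdelta.intros open_vimage U(1) assms(1))
  ultimately show ?thesis by simp
qed

lemma not_gdelta_borel_omega_powers:
  "\<not> gdelta (dictionaries_omega_power_in (sets borel))"
proof
  assume "gdelta (dictionaries_omega_power_in (sets borel))"
  then have "gdelta (search_dictionary -` dictionaries_omega_power_in (sets borel))"
    by (rule gdelta_vimage[OF continuous_search_dictionary])
  moreover have "search_dictionary -` dictionaries_omega_power_in (sets borel) = {S. finite {k. S k}}"
    by (auto simp: dictionaries_omega_power_in_def borel_search_power_iff)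
  ultimately show False using finite_sets_not_gdelta by simp
qed

theorem corollary3p2:
  shows "Sigma12 (dictionaries_omega_power_in (sets borel))
       \<and> \<not> gdelta (dictionaries_omega_power_in (sets borel))"
  using Sigma12_borel_omega_powers not_gdelta_borel_omega_powers by blast

end
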